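(* Let $(D,A,B)$ be a bipartite web with $|A|>|B|$. Then $(D,A,B)$ contains a hindrance.
   Context: A bipartite web is a triple $(D,A,B)$ where $D$ is a digraph with $V(D)=A\cup B$, $A\cap B=\emptyset$, and every edge of $D$ goes from a vertex of $A$ to a vertex of $B$. Paths are simple directed paths with initial vertex $in(P)$ and, if finite, terminal vertex $ter(P)$; single vertices are paths. A warp is a set of pairwise vertex-disjoint paths; $in[\mathcal W]$ and $ter[\mathcal W]$ denote initial vertices of its paths and terminal vertices of its finite paths. A wave is a warp $\mathcal W$ with $in[\mathcal W]\subseteq A$ such that every finite path from $A$ to $B$ contains a vertex of $ter[\mathcal W]$. A hindrance is a wave $\mathcal W$ with $in[\mathcal W]\ne A$. *)

theory Defs
  imports "Graph_Theory.Pair_Digraph" "Graph_Theory.Vertex_Walk"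
begin

unbundle cardinal_syntax

definition bipartite_web :: "'a pair_pre_digraph \<Rightarrow> 'a set \<Rightarrow> 'a set \<Rightarrow> bool" where
  "bipartite_web D A B \<longleftrightarrow>
     pair_wf_digraph D \<and> pverts D = A \<union> B \<and> A \<inter> B = {} \<and> parcs D \<subseteq> A \<times> B"

text \<open>Paths have an initial vertex and may be infinite in the forward direction only. As there
  are no parallel edges, a path is determined by its sequence of vertices.\<close>

datatype 'a dipath = Finite_Path "'a list" | Ray "nat \<Rightarrow> 'a"

fun is_path :: "'a pair_pre_digraph \<Rightarrow> 'a dipath \<Rightarrow> bool" where
  "is_path D (Finite_Path p) \<longleftrightarrow> vpath p (with_proj D)"
| "is_path D (Ray f) \<longleftrightarrow> inj f \<and> range f \<subseteq> pverts D \<and> (\<forall>n. (f n, f (Suc n)) \<in> parcs D)"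

fun path_verts :: "'a dipath \<Rightarrow> 'a set" where
  "path_verts (Finite_Path p) = set p"
| "path_verts (Ray f) = range f"

fun path_init :: "'a dipath \<Rightarrow> 'a" where
  "path_init (Finite_Path p) = hd p"
| "path_init (Ray f) = f 0"

definition warp :: "'a pair_pre_digraph \<Rightarrow> 'a dipath set \<Rightarrow> bool" where
  "warp D W \<longleftrightarrow>
     (\<forall>P\<in>W. is_path D P) \<and> pairwise (\<lambda>P Q. disjnt (path_verts P) (path_verts Q)) W"

definition init_verts :: "'a dipath set \<Rightarrow> 'a set" where
  "init_verts W = path_init ` W"

definition ter_verts :: "'a dipath set \<Rightarrow> 'a set" where
  "ter_verts W = {last p | p. Finite_Path p \<in> W}"

definition wave :: "'a pair_pre_digraph \<Rightarrow> 'a set \<Rightarrow> 'a set \<Rightarrow> 'a dipath set \<Rightarrow> bool" where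
  "wave D A B W \<longleftrightarrow>
     warp D W \<and> init_verts W \<subseteq> A \<and>
     (\<forall>p. is_path D (Finite_Path p) \<and> hd p \<in> A \<and> last p \<in> B \<longrightarrow> set p \<inter> ter_verts W \<noteq> {})"

definition hindrance :: "'a pair_pre_digraph \<Rightarrow> 'a set \<Rightarrow> 'a set \<Rightarrow> 'a dipath set \<Rightarrow> bool" where
  "hindrance D A B W \<longleftrightarrow> wave D A B W \<and> init_verts W \<noteq> A"

end

theory Submission
  imports Defs
begin

text \<open>
  In a bipartite web a hindrance amounts to a set \<open>Y \<subseteq> A\<close> whose neighbourhood in \<open>B\<close> can be matched
  into a proper subset of \<open>Y\<close>: take the matching edges together with the trivial paths at the
  vertices of \<open>A - Y\<close>. For finite \<open>B\<close> such a \<open>Y\<close> is found by deleting Hall violators \<open>T \<subseteq> B\<close>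
  together with their neighbours, which preserves \<open>|B| < |A|\<close>, until Hall's condition holds. For
  infinite \<open>B\<close> let \<open>Y\<close> be the set of vertices of \<open>A\<close> that are not adjacent to any vertex of degree
  at most \<open>|B|\<close>. Only \<open>|B|\<close> many vertices are lost, so each vertex in the neighbourhood of \<open>Y\<close>
  still has more than \<open>|B|\<close> neighbours in \<open>Y\<close>, and a greedy matching exists.
\<close>

section \<open>Matchings: Hall's theorem and a greedy cardinality version\<close>

text \<open>The Halmos-Vaughan induction: a nonempty proper tight subset \<open>T\<close> splits the
  problem into \<open>T\<close> and its complement; without one, every nonempty proper subset has a
  surplus, so one value can be fixed freely.\<close>

lemma hall_marriage:
  fixes N :: "'i \<Rightarrow> 'a set"
  assumes "finite I" "\<And>i. i \<in> I \<Longrightarrow> finite (N i)"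
    and "\<And>T. T \<subseteq> I \<Longrightarrow> card T \<le> card (\<Union>i\<in>T. N i)"
  shows "\<exists>f. inj_on f I \<and> (\<forall>i\<in>I. f i \<in> N i)"
  using assms
proof (induction I arbitrary: N rule: finite_psubset_induct)
  case (psubset I)
  note fin = psubset.prems(1) and hall = psubset.prems(2)
  consider "I = {}" | T where "T \<subset> I" "T \<noteq> {}" "card (\<Union>i\<in>T. N i) = card T"
    | "I \<noteq> {}" "\<And>T. T \<subset> I \<Longrightarrow> T \<noteq> {} \<Longrightarrow> card T < card (\<Union>i\<in>T. N i)"
    using hall by (metis le_neq_implies_less psubset_imp_subset)
  then show ?case
  proof cases
    case 1
    then show ?thesis by simp
  next
    case (2 T)
    define K where "K = (\<Union>i\<in>T. N i)"
    have finT: "finite T" using 2(1) psubset.hyps by (meson finite_subset psubset_imp_subset)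
    then have finK: "finite K" unfolding K_def using 2(1) fin by blast
    have "\<exists>f. inj_on f T \<and> (\<forall>i\<in>T. f i \<in> N i)"
    proof (rule psubset.IH[OF 2(1)])
      show "finite (N i)" if "i \<in> T" for i using that 2(1) by (intro fin) auto
      show "card U \<le> card (\<Union>i\<in>U. N i)" if "U \<subseteq> T" for U using that 2(1) by (intro hall) auto
    qed
    then obtain f where f: "inj_on f T" "\<forall>i\<in>T. f i \<in> N i" by blast
    have "\<exists>g. inj_on g (I - T) \<and> (\<forall>i\<in>I - T. g i \<in> N i - K)"
    proof (rule psubset.IH)
      show "I - T \<subset> I" using 2 by blast
      show "finite (N i - K)" if "i \<in> I - T" for i using that fin by blast
      fix U assume U: "U \<subseteq> I - T"
      then have finU: "finite U" using psubset.hyps by (meson finite_Diff finite_subset)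
      have finNU: "finite (\<Union>i\<in>U. N i - K)" using finU U fin by blast
      \<comment> \<open>Hall's condition for \<open>U \<union> T\<close>, minus the tight equality
        \<open>card K = card T\<close>, gives it for \<open>U\<close> after the values in
        \<open>K\<close> are removed.\<close>
      have "card U + card T = card (U \<union> T)"
        using U finU finT by (subst card_Un_disjoint) auto
      also have "\<dots> \<le> card (\<Union>i\<in>U \<union> T. N i)"
        using U 2(1) by (intro hall) blast
      also have "(\<Union>i\<in>U \<union> T. N i) = (\<Union>i\<in>U. N i - K) \<union> K" unfolding K_def by blast
      also have "card \<dots> = card (\<Union>i\<in>U. N i - K) + card K"
        using finNU finK by (intro card_Un_disjoint) auto
      finally show "card U \<le> card (\<Union>i\<in>U. N i - K)" using 2(3) by (simp add: K_def)
    qed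
    then obtain g where g: "inj_on g (I - T)" "\<forall>i\<in>I - T. g i \<in> N i - K" by blast
    let ?h = "\<lambda>i. if i \<in> T then f i else g i"
    have "inj_on ?h (T \<union> (I - T))"
    proof (rule inj_on_disjoint_Un)
      have "f ` T \<subseteq> K" using f(2) by (auto simp: K_def)
      moreover have "g ` (I - T) \<inter> K = {}" using g(2) by auto
      ultimately show "f ` T \<inter> g ` (I - T) = {}" by blast
    qed (use f(1) g(1) in auto)
    moreover have "T \<union> (I - T) = I" using 2(1) by blast
    ultimately have "inj_on ?h I" by simp
    moreover have "\<forall>i\<in>I. ?h i \<in> N i" using f(2) g(2) by auto
    ultimately show ?thesis by blast
  next
    case 3
    then obtain i where i: "i \<in> I" by blast
    have "card {i} \<le> card (N i)" using hall[of "{i}"] i by simp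
    then obtain a where a: "a \<in> N i" by (cases "N i = {}") auto
    have "\<exists>g. inj_on g (I - {i}) \<and> (\<forall>j\<in>I - {i}. g j \<in> N j - {a})"
    proof (rule psubset.IH)
      show "I - {i} \<subset> I" using i by blast
      show "finite (N j - {a})" if "j \<in> I - {i}" for j using that fin by blast
      fix U assume U: "U \<subseteq> I - {i}"
      show "card U \<le> card (\<Union>j\<in>U. N j - {a})"
      proof (cases "U = {}")
        case False
        \<comment> \<open>The surplus of at least one absorbs the loss of \<open>a\<close>.\<close>
        have "card U < card (\<Union>j\<in>U. N j)" using U i False by (intro 3(2)) blast+
        moreover have "(\<Union>j\<in>U. N j - {a}) = (\<Union>j\<in>U. N j) - {a}" by blast
        ultimately show ?thesis by (auto simp: card_Diff_singleton_if)
      qed simp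
    qed
    then obtain g where g: "inj_on g (I - {i})" "\<forall>j\<in>I - {i}. g j \<in> N j - {a}" by blast
    have "inj_on (g(i := a)) I"
      using g by (auto simp: inj_on_def)
    moreover have "\<forall>j\<in>I. (g(i := a)) j \<in> N j" using g(2) a by auto
    ultimately show ?thesis by blast
  qed
qed

text \<open>Zorn's lemma replaces a transfinite recursion: a partial matching uses at most
  \<open>|I|\<close> values, so at an unmatched index a free value remains and the matching is not
  maximal.\<close>

lemma greedy_matching:
  fixes N :: "'i \<Rightarrow> 'a set"
  assumes big: "\<And>i. i \<in> I \<Longrightarrow> |I| <o |N i|"
  shows "\<exists>f. inj_on f I \<and> (\<forall>i\<in>I. f i \<in> N i)"
proof -
  \<comment> \<open>Partial matchings are relations, so that the upper bound of a chain is its plain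
    union; single-valuedness of the converse is injectivity.\<close>
  define \<M> where "\<M> = {M. M \<subseteq> Sigma I N \<and> single_valued M \<and> single_valued (M\<inverse>)}"
  have "\<Union>C \<in> \<M>" if C: "subset.chain \<M> C" for C
  proof -
    have sub: "C \<subseteq> \<M>" and lin: "\<And>M M'. M \<in> C \<Longrightarrow> M' \<in> C \<Longrightarrow> M \<subseteq> M' \<or> M' \<subseteq> M"
      using C by (auto simp: subset_chain_def)
    have "\<exists>M\<in>C. p \<in> M \<and> q \<in> M" if "p \<in> \<Union>C" "q \<in> \<Union>C" for p q
      using that lin by blast
    then have *: "\<exists>M\<in>\<M>. p \<in> M \<and> q \<in> M" if "p \<in> \<Union>C" "q \<in> \<Union>C" for p q
      using that sub by (meson subset_iff)
    have "single_valued (\<Union>C)"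
    proof (rule single_valuedI)
      fix i a a' assume "(i, a) \<in> \<Union>C" "(i, a') \<in> \<Union>C"
      then obtain M where "M \<in> \<M>" "(i, a) \<in> M" "(i, a') \<in> M" using * by meson
      then show "a = a'" by (auto simp: \<M>_def dest: single_valuedD)
    qed
    moreover have "single_valued ((\<Union>C)\<inverse>)"
    proof (rule single_valuedI)
      fix i i' a assume "(a, i) \<in> (\<Union>C)\<inverse>" "(a, i') \<in> (\<Union>C)\<inverse>"
      then obtain M where "M \<in> \<M>" "(a, i) \<in> M\<inverse>" "(a, i') \<in> M\<inverse>" using * by (meson converse_iff)
      then show "i = i'" by (auto simp: \<M>_def simp del: converse_iff dest: single_valuedD)
    qed
    moreover have "\<Union>C \<subseteq> Sigma I N" using sub by (auto simp: \<M>_def)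
    ultimately show ?thesis by (simp add: \<M>_def)
  qed
  then obtain M where M: "M \<in> \<M>" and max: "\<And>X. X \<in> \<M> \<Longrightarrow> M \<subseteq> X \<Longrightarrow> X = M"
    using subset_Zorn'[of \<M>] by blast
  have MS: "M \<subseteq> Sigma I N" and sv: "single_valued M" and svi: "single_valued (M\<inverse>)"
    using M by (auto simp: \<M>_def)
  have dom: "i \<in> Domain M" if i: "i \<in> I" for i
  proof (rule ccontr)
    assume ni: "i \<notin> Domain M"
    let ?g = "\<lambda>a. SOME j. (j, a) \<in> M"
    have g: "(?g a, a) \<in> M" if "a \<in> Range M" for a
      using that by (metis (mono_tags, lifting) Range.cases someI_ex)
    have "inj_on ?g (Range M)"
      using g sv by (metis (mono_tags, lifting) inj_onI single_valuedD)
    moreover have "?g ` Range M \<subseteq> I" using g MS by blast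
    ultimately have "|Range M| \<le>o |I|" by (metis card_of_ordLeq)
    then have "|Range M| <o |N i|" using big[OF i] by (rule ordLeq_ordLess_trans)
    then have "\<not> N i \<subseteq> Range M" by (meson card_of_mono1 not_ordLess_ordLeq)
    then obtain a where a: "a \<in> N i" "a \<notin> Range M" by blast
    have "insert (i, a) M \<in> \<M>"
      using MS sv svi i a ni by (auto simp: \<M>_def single_valued_def Domain_iff Range_iff)
    then have "(i, a) \<in> M" using max by blast
    then show False using ni by blast
  qed
  let ?f = "\<lambda>i. SOME a. (i, a) \<in> M"
  have f: "(?f i, i) \<in> M\<inverse>" if "i \<in> I" for i
    using dom[OF that] by (metis (mono_tags, lifting) Domain.cases converse_iff someI_ex)
  have "inj_on ?f I"
    using f svi by (metis (mono_tags, lifting) inj_onI single_valuedD)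
  moreover have "\<forall>i\<in>I. ?f i \<in> N i" using f MS by blast
  ultimately show ?thesis by blast
qed

section \<open>Overmatched sets and their existence\<close>

text \<open>Each neighbour picks its partner in \<open>Y\<close>, so the last conjunct leaves a
  vertex of \<open>Y\<close> unmatched. The ambient sides do not occur, so the property passes
  unchanged from a reduced web to the original one.\<close>

definition overmatched :: "('a \<times> 'b) set \<Rightarrow> 'a set \<Rightarrow> bool" where
  "overmatched E Y \<longleftrightarrow>
     (\<exists>f. inj_on f (E `` Y) \<and> (\<forall>b\<in>E `` Y. f b \<in> Y \<and> (f b, b) \<in> E) \<and> f ` (E `` Y) \<noteq> Y)"

lemma overmatched_finite:
  assumes "finite B" "finite A" "card B < card A" "E `` A \<subseteq> B"
  shows "\<exists>Y\<subseteq>A. overmatched E Y"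
  using assms
proof (induction B arbitrary: A rule: finite_psubset_induct)
  case (psubset B)
  note finA = psubset.prems(1) and less = psubset.prems(2) and EA = psubset.prems(3)
  let ?N = "\<lambda>b. {a \<in> A. (a, b) \<in> E}"
  have finN: "finite (?N b)" for b using finA by simp
  show ?case
  proof (cases "\<forall>T\<subseteq>B. card T \<le> card (\<Union>b\<in>T. ?N b)")
    case True
    then obtain f where f: "inj_on f B" "\<forall>b\<in>B. f b \<in> ?N b"
      using hall_marriage[of B ?N] psubset.hyps finN by blast
    have "card (f ` (E `` A)) \<le> card B"
      using EA psubset.hyps by (meson card_image_le card_mono finite_subset le_trans)
    then have "f ` (E `` A) \<noteq> A" using less by force
    then have "overmatched E A"
      unfolding overmatched_def using f EA by (intro exI[of _ f]) (auto intro: inj_on_subset)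
    then show ?thesis by blast
  next
    case False
    then obtain T where T: "T \<subseteq> B" "card (\<Union>b\<in>T. ?N b) < card T" by (meson not_le)
    let ?K = "\<Union>b\<in>T. ?N b"
    have finT: "finite T" using T(1) psubset.hyps finite_subset by blast
    have "?K \<subseteq> A" by blast
    then have "card (A - ?K) = card A - card ?K" "card ?K \<le> card A"
      using finA by (auto intro!: card_Diff_subset card_mono intro: finite_subset)
    moreover have "card (B - T) = card B - card T" "card T \<le> card B"
      using T(1) finT psubset.hyps by (auto intro!: card_Diff_subset card_mono)
    ultimately have "card (B - T) < card (A - ?K)" using T(2) less by linarith
    moreover have "B - T \<subset> B"
    proof -
      have "0 < card T" using T(2) by linarith
      then have "T \<noteq> {}" by (simp add: card_gt_0_iff)
      then show ?thesis using T(1) by blast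
    qed
    \<comment> \<open>All neighbours of \<open>T\<close> in \<open>A\<close> are gone, so no edge
      from the remaining vertices ends in \<open>T\<close>.\<close>
    moreover have "E `` (A - ?K) \<subseteq> B - T" using EA by blast
    ultimately have "\<exists>Y\<subseteq>A - ?K. overmatched E Y" using finA by (intro psubset.IH) simp_all
    then show ?thesis by blast
  qed
qed

text \<open>Otherwise the infinite set \<open>A\<close> would be covered by two sets of smaller
  cardinality, \<open>A - K\<close> and \<open>K\<close>.\<close>

lemma card_of_Diff_gt:
  assumes "infinite B" "|B| <o |A|" "|K| \<le>o |B|"
  shows "|B| <o |A - K|"
proof (rule ccontr)
  assume "\<not> |B| <o |A - K|"
  then have "|A - K| \<le>o |B|"
    using not_ordLess_iff_ordLeq[OF card_of_Well_order card_of_Well_order] by (rule iffD1[rotated])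
  then have "|A - K| <o |A|" using assms(2) by (rule ordLeq_ordLess_trans)
  moreover have "|K| <o |A|" using assms(3,2) by (rule ordLeq_ordLess_trans)
  moreover have "infinite A" using assms(1,2) card_of_ordLeq_infinite ordLess_imp_ordLeq by blast
  ultimately have "|(A - K) \<union> K| <o |A|" by (intro card_of_Un_ordLess_infinite)
  moreover have "|A| \<le>o |(A - K) \<union> K|" by (rule card_of_mono1) blast
  ultimately show False using not_ordLess_ordLeq by blast
qed

lemma overmatched_infinite:
  assumes inf: "infinite B" and less: "|B| <o |A|" and EA: "E `` A \<subseteq> B"
  shows "\<exists>Y\<subseteq>A. overmatched E Y"
proof -
  let ?N = "\<lambda>b. {a \<in> A. (a, b) \<in> E}"
  define S where "S = {b \<in> B. |?N b| \<le>o |B|}"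
  define K where "K = (\<Union>b\<in>S. ?N b)"
  define Y where "Y = A - K"
  \<comment> \<open>A union of at most \<open>|B|\<close> sets of size at most \<open>|B|\<close>,
    with \<open>B\<close> infinite.\<close>
  have K: "|K| \<le>o |B|"
    unfolding K_def using inf
    by (rule card_of_UNION_ordLeq_infinite) (auto simp: S_def intro: card_of_mono1)
  have Y: "|B| <o |Y|" unfolding Y_def using inf less K by (rule card_of_Diff_gt)
  have EYB: "E `` Y \<subseteq> B" using EA by (auto simp: Y_def)
  then have EY_le: "|E `` Y| \<le>o |B|" by (rule card_of_mono1)
  have "|E `` Y| <o |?N b - K|" if b: "b \<in> E `` Y" for b
  proof -
    \<comment> \<open>A neighbour of \<open>b\<close> in \<open>Y\<close> avoids \<open>K\<close>,
      whereas \<open>K\<close> contains all neighbours in \<open>A\<close> of each vertex of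
      \<open>S\<close>.\<close>
    have "b \<notin> S" using b by (auto simp: Y_def K_def)
    then have "\<not> |?N b| \<le>o |B|" using b EYB by (auto simp: S_def)
    then have "|B| <o |?N b|"
      using not_ordLeq_iff_ordLess[OF card_of_Well_order card_of_Well_order] by (rule iffD1[rotated])
    then have "|B| <o |?N b - K|" using inf K by (intro card_of_Diff_gt)
    then show ?thesis using EY_le by (rule ordLeq_ordLess_trans[rotated])
  qed
  then obtain f where f: "inj_on f (E `` Y)" "\<forall>b\<in>E `` Y. f b \<in> ?N b - K"
    using greedy_matching[of "E `` Y" "\<lambda>b. ?N b - K"] by blast
  have "|f ` (E `` Y)| <o |Y|"
    by (rule ordLeq_ordLess_trans[OF ordLeq_transitive[OF card_of_image EY_le] Y])
  then have "f ` (E `` Y) \<noteq> Y" using ordLess_irreflexive by force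
  then have "overmatched E Y"
    unfolding overmatched_def using f by (intro exI[of _ f]) (auto simp: Y_def)
  then show ?thesis by (auto simp: Y_def)
qed

lemma overmatched_if_card_less:
  assumes less: "|B| <o |A|" and EA: "E `` A \<subseteq> B"
  shows "\<exists>Y\<subseteq>A. overmatched E Y"
proof (cases "finite B")
  case True
  \<comment> \<open>The finite case needs a finite left side; if \<open>A\<close> is infinite, a
    large enough finite subset serves.\<close>
  have "\<exists>A'\<subseteq>A. finite A' \<and> card B < card A'"
  proof (cases "finite A")
    case True
    then have "card B < card A"
      using less \<open>finite B\<close> card_of_ordLess[of A B] inj_on_iff_card_le[of A B] by simp
    then show ?thesis using True by blast
  next
    case False
    then show ?thesis by (metis infinite_arbitrarily_large lessI)
  qed
  then obtain A' where A': "A' \<subseteq> A" "finite A'" "card B < card A'" by blast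
  then have "\<exists>Y\<subseteq>A'. overmatched E Y"
    using EA True by (intro overmatched_finite[of B]) auto
  then show ?thesis using A'(1) by blast
qed (use assms overmatched_infinite in blast)

section \<open>From overmatched sets to hindrances\<close>

lemma hindrance_if_overmatched:
  assumes web: "bipartite_web D A B" and YA: "Y \<subseteq> A" and Y: "overmatched (parcs D) Y"
  shows "\<exists>W. hindrance D A B W"
proof -
  define T where "T = parcs D `` Y"
  obtain f where inj: "inj_on f T" and f: "\<And>b. b \<in> T \<Longrightarrow> f b \<in> Y \<and> (f b, b) \<in> parcs D"
    and ne: "f ` T \<noteq> Y"
    using Y unfolding overmatched_def T_def by blast
  have V: "pverts D = A \<union> B" and disj: "A \<inter> B = {}" and arcs: "parcs D \<subseteq> A \<times> B"
    using web by (auto simp: bipartite_web_def)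
  have TB: "T \<subseteq> B" using arcs by (auto simp: T_def)
  define W where "W = (\<lambda>a. Finite_Path [a]) ` (A - Y) \<union> (\<lambda>b. Finite_Path [f b, b]) ` T"
  have ends: "arcs_ends (with_proj D) = parcs D"
    by (auto simp: arcs_ends_def arc_to_ends_def)
  have edge: "f b \<in> A \<and> f b \<in> Y \<and> b \<in> B \<and> (f b, b) \<in> parcs D \<and> f b \<noteq> b" if "b \<in> T" for b
    using f[OF that] YA TB that disj by (metis IntI emptyE subsetD)
  have paths: "is_path D P" if "P \<in> W" for P
    using that unfolding W_def
    by (auto simp: vpath_def vwalk_def ends V dest!: edge)
  have "pairwise (\<lambda>P Q. disjnt (path_verts P) (path_verts Q)) W"
  proof (rule pairwiseI)
    fix P Q assume PQ: "P \<in> W" "Q \<in> W" "P \<noteq> Q"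
    consider a where "a \<in> A - Y" "P = Finite_Path [a]" | b where "b \<in> T" "P = Finite_Path [f b, b]"
      using PQ(1) by (auto simp: W_def)
    then show "disjnt (path_verts P) (path_verts Q)"
      using PQ(2,3) unfolding W_def
      by cases (use edge disj inj in \<open>fastforce simp: disjnt_def dest: inj_onD\<close>)+
  qed
  with paths have warp: "warp D W" by (simp add: warp_def)
  have init: "init_verts W = (A - Y) \<union> f ` T"
    by (simp add: init_verts_def W_def image_Un image_image)
  have ter: "A - Y \<union> T \<subseteq> ter_verts W"
  proof
    fix v assume "v \<in> A - Y \<union> T"
    then have "Finite_Path [v] \<in> W \<or> Finite_Path [f v, v] \<in> W" by (auto simp: W_def)
    then show "v \<in> ter_verts W"
      unfolding ter_verts_def by (metis (mono_tags, lifting) last.simps list.distinct(1) mem_Collect_eq)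
  qed
  have "set p \<inter> ter_verts W \<noteq> {}"
    if p: "is_path D (Finite_Path p)" "hd p \<in> A" "last p \<in> B" for p
  proof -
    \<comment> \<open>As \<open>A\<close> and \<open>B\<close> are disjoint, the path has a first
      edge \<open>(a, b)\<close>: either \<open>a\<close> is a trivial path of \<open>W\<close>, or
      \<open>a\<close> lies in \<open>Y\<close> and \<open>b\<close> ends a matching edge.\<close>
    obtain a b q where pq: "p = a # b # q"
      using p disj by (cases p rule: vwalk_arcs.cases) (auto simp: vpath_def vwalk_def)
    then have "(a, b) \<in> parcs D" "a \<in> A" using p by (auto simp: vpath_def vwalk_def ends)
    then have "a \<in> A - Y \<or> b \<in> T" by (auto simp: T_def)
    then show ?thesis using ter pq by auto
  qed
  moreover have "init_verts W \<subseteq> A" using init edge by auto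
  moreover have "init_verts W \<noteq> A" using init ne f YA by blast
  ultimately have "hindrance D A B W" using warp by (simp add: hindrance_def wave_def)
  then show ?thesis by blast
qed

theorem theorem8p1:
  fixes D :: "'a pair_pre_digraph" and A B :: "'a set"
  assumes "bipartite_web D A B"
    and "|B| <o |A|"
  shows "\<exists>W. hindrance D A B W"
proof -
  have "parcs D `` A \<subseteq> B" using assms(1) by (auto simp: bipartite_web_def)
  then show ?thesis
    using overmatched_if_card_less[OF assms(2)] hindrance_if_overmatched[OF assms(1)] by blast
qed

end
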